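(* For an unlabeled binary tree $T$, define $\mathbf{Q}'_T=\sum_{\sigma:\ \mathrm{shape}(\mathrm{bst}(\sigma))=T}\mathbf{Q}_{\mathrm{shape}(\mathrm{bst}(\sigma^{-1}))}$. Then $(\mathbf{Q}'_T)_T$, $T$ running over all binary trees, is a basis of $\mathbf{PBT}^*$. Moreover the transition matrix is triangular: for every tree $T$, identifying trees with their canonical words, $$\mathbf{Q}'_{w_T}=\mathbf{Q}_{w_T^{-1}}+\sum_\tau \mathbf{Q}_\tau,$$ where $w_T^{-1}$ is itself a canonical word and $\tau$ runs over (a multiset of) canonical words strictly greater than $w_T^{-1}$ for the lexicographic order.
   Context: For a word $w$, $\mathrm{std}(w)$ is obtained by scanning $w$ left to right and labelling $1,2,\dots$ the occurrences of its smallest letter, then the next smallest, etc. For $\sigma\in S_n$, $\mathbf{F}_\sigma=\sum_{\mathrm{std}(w)=\sigma^{-1}}w$ in $\mathbb{K}\langle A\rangle$ ($A=\{1<2<\cdots\}$, $\mathbb{K}$ of characteristic $0$); $\mathbf{FQSym}$ is the Hopf algebra they span. A binary tree is empty or a node with left and right subtrees. $\mathrm{bst}(w)$ is obtained by reading $w$ right to left and inserting each letter $x$: into an empty tree create a node labeled $x$; otherwise insert recursively into the left subtree if $x\le$ root label, into the right subtree if $x>$ root label. For an unlabeled tree $T$ with $n$ nodes, the canonical word $w_T\in S_n$ is the right-to-left postfix reading (right subtree, left subtree, root, recursively) of the unique labeling of $T$ by $1,\dots,n$ with each label greater than those of its left subtree and smaller than those of its right subtree; $T\mapsto w_T$ is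 injective, so trees may be indexed by their canonical words. $\mathbf{P}_T=\sum_{\mathrm{shape}(\mathrm{bst}(\sigma))=T}\mathbf{F}_\sigma$; $\mathbf{PBT}$ is the Hopf subalgebra of $\mathbf{FQSym}$ with basis $(\mathbf{P}_T)$, $\mathbf{PBT}^*$ its graded dual Hopf algebra, and $(\mathbf{Q}_T)$ the basis of $\mathbf{PBT}^*$ dual to $(\mathbf{P}_T)$. *)

theory Defs
  imports
    Complex_Main
    "HOL-Library.Function_Algebras"
    "HOL-Library.Multiset"
    "HOL-Library.Tree"
    "HOL-Combinatorics.Multiset_Permutations"
begin

text \<open>
  Words are lists of natural numbers; the alphabet is the set of positive integers.
  A permutation in \<open>S\<^sub>n\<close> is written in one-line notation, that is, as an element of
  \<^term>\<open>permutations_of_set {1..n::nat}\<close>.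
\<close>

definition inv_perm :: "nat list \<Rightarrow> nat list" where
  "inv_perm \<sigma> =
     map (\<lambda>i. THE k. k \<in> {1..length \<sigma>} \<and> \<sigma> ! (k - 1) = i) [1..<Suc (length \<sigma>)]"

text \<open>
  The label received by position \<open>i\<close> is the number of positions labelled no later than it:
  those carrying a smaller letter, and those carrying the same letter weakly to its left.
\<close>

definition std :: "nat list \<Rightarrow> nat list" where
  "std w =
     map (\<lambda>i. card {j. j < length w \<and> w ! j < w ! i} + card {j. j \<le> i \<and> w ! j = w ! i})
       [0..<length w]"

definition shape :: "'a tree \<Rightarrow> unit tree" where
  "shape t = map_tree (\<lambda>_. ()) t"

fun bst_insert :: "nat \<Rightarrow> nat tree \<Rightarrow> nat tree" where
  "bst_insert x Leaf = Node Leaf x Leaf"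
| "bst_insert x (Node l a r) =
     (if x \<le> a then Node (bst_insert x l) a r else Node l a (bst_insert x r))"

text \<open>The last letter of the word is inserted first. (The library predicate \<^const>\<open>bst\<close>
  is the strict search tree property.)\<close>

definition bst_of :: "nat list \<Rightarrow> nat tree" where
  "bst_of w = foldr bst_insert w Leaf"

definition canonical_labelling :: "unit tree \<Rightarrow> nat tree" where
  "canonical_labelling T = (THE t. shape t = T \<and> set_tree t = {1..size T} \<and> bst t)"

fun rl_postfix :: "'a tree \<Rightarrow> 'a list" where
  "rl_postfix Leaf = []"
| "rl_postfix (Node l a r) = rl_postfix r @ rl_postfix l @ [a]"

definition canonical_word :: "unit tree \<Rightarrow> nat list" where
  "canonical_word T = rl_postfix (canonical_labelling T)"

text \<open>Since \<^const>\<open>bst_of\<close> preserves the number of letters, this is the set of all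
  permutations, of any size, whose search tree has shape \<open>T\<close>.\<close>

definition sylvester_class :: "unit tree \<Rightarrow> nat list set" where
  "sylvester_class T = {\<sigma> \<in> permutations_of_set {1..size T}. shape (bst_of \<sigma>) = T}"

definition fscale :: "'k::field \<Rightarrow> ('x \<Rightarrow> 'k) \<Rightarrow> 'x \<Rightarrow> 'k" where
  "fscale c f = (\<lambda>x. c * f x)"

global_interpretation fs: vector_space "fscale :: 'k::field \<Rightarrow> ('x \<Rightarrow> 'k) \<Rightarrow> 'x \<Rightarrow> 'k"
  by standard (auto simp: fscale_def fun_eq_iff algebra_simps)

definition is_basis :: "('i \<Rightarrow> 'x \<Rightarrow> 'k::field) \<Rightarrow> ('x \<Rightarrow> 'k) set \<Rightarrow> bool" where
  "is_basis B V \<longleftrightarrow> inj B \<and> fs.independent (range B) \<and> fs.span (range B) = V"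

text \<open>A (possibly infinite) linear combination of words is the function giving its
  coefficients.\<close>

definition F_FQSym :: "nat list \<Rightarrow> nat list \<Rightarrow> 'k::field_char_0" where
  "F_FQSym \<sigma> = (\<lambda>w. if 0 \<notin> set w \<and> std w = inv_perm \<sigma> then 1 else 0)"

definition P_PBT :: "unit tree \<Rightarrow> nat list \<Rightarrow> 'k::field_char_0" where
  "P_PBT T = (\<Sum>\<sigma> \<in> sylvester_class T. F_FQSym \<sigma>)"

definition PBT :: "(nat list \<Rightarrow> 'k::field_char_0) set" where
  "PBT = fs.span (range P_PBT)"

definition PBT_homogeneous :: "nat \<Rightarrow> (nat list \<Rightarrow> 'k::field_char_0) set" where
  "PBT_homogeneous n = {f \<in> PBT. \<forall>w. f w \<noteq> 0 \<longrightarrow> length w = n}"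

text \<open>
  Underlying vector space of the graded dual: linear forms on \<^const>\<open>PBT\<close> vanishing on all
  but finitely many homogeneous components. A linear form on the subspace \<^const>\<open>PBT\<close> is
  represented by its extension by zero to all functions, so that equality of linear forms is
  equality of functions.
\<close>

definition PBT_dual :: "((nat list \<Rightarrow> 'k::field_char_0) \<Rightarrow> 'k) set" where
  "PBT_dual = {\<phi>.
     (\<forall>f \<in> PBT. \<forall>g \<in> PBT. \<phi> (f + g) = \<phi> f + \<phi> g) \<and>
     (\<forall>c. \<forall>f \<in> PBT. \<phi> (fscale c f) = c * \<phi> f) \<and>
     (\<forall>f. f \<notin> PBT \<longrightarrow> \<phi> f = 0) \<and>
     finite {n. \<exists>f \<in> PBT_homogeneous n. \<phi> f \<noteq> 0}}"

definition Q_PBT :: "unit tree \<Rightarrow> (nat list \<Rightarrow> 'k::field_char_0) \<Rightarrow> 'k" where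
  "Q_PBT T = (THE \<phi>. \<phi> \<in> PBT_dual \<and> (\<forall>S. \<phi> (P_PBT S) = (if S = T then 1 else 0)))"

definition Q'_PBT :: "unit tree \<Rightarrow> (nat list \<Rightarrow> 'k::field_char_0) \<Rightarrow> 'k" where
  "Q'_PBT T = (\<Sum>\<sigma> \<in> sylvester_class T. Q_PBT (shape (bst_of (inv_perm \<sigma>))))"

end

theory Submission
  imports Defs
begin

text \<open>
  The word \<open>\<sigma>\<close> has search tree \<open>T\<close> if and only if \<open>\<rho> = \<sigma>\<^sup>-\<^sup>1\<close> has decreasing tree \<open>T\<close> (root at the
  maximal letter). Writing \<open>\<rho> = L m R\<close> with \<open>m\<close> maximal, \<open>u = w\<^sub>T\<^sup>-\<^sup>1\<close> is the word for which, recursively,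
  all letters of \<open>L\<close> exceed those of \<open>R\<close>, i.e. the one avoiding 132. The canonical word of the
  search tree of \<open>\<rho>\<close> is \<open>\<tau>(\<rho>) = \<tau>(U) m \<tau>(V)\<close>, where \<open>U\<close> consists of the letters of \<open>L\<close> exceeding all of
  \<open>R\<close>. If \<open>U = L\<close>, induction applies to both factors. Otherwise \<open>\<tau>(U)\<close> is shorter than \<open>L\<close> and,
  because \<open>U\<close> consists of the largest letters of \<open>L\<close>, either is a prefix of \<open>\<tau>(L)\<close> or exceeds it at
  the first difference; the letter \<open>m\<close> following \<open>\<tau>(U)\<close> decides the former case, so \<open>\<tau>(\<rho>) > u\<close>.
\<close>

section \<open>Search trees\<close>

lemma shape_simps [simp]:
  "shape Leaf = Leaf" "shape (Node l a r) = Node (shape l) () (shape r)"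
  by (simp_all add: shape_def)

lemma size_shape [simp]: "size (shape t) = size t"
  by (simp add: shape_def)

lemma shape_inorder_inject:
  "shape t = shape t' \<Longrightarrow> inorder t = inorder t' \<Longrightarrow> t = t'"
proof (induction t arbitrary: t')
  case Leaf
  then show ?case by (cases t') auto
next
  case (Node l a r)
  then obtain l' a' r' where t': "t' = Node l' a' r'" "shape l = shape l'" "shape r = shape r'"
    by (cases t') auto
  have "length (inorder l) = length (inorder l')"
    using t'(2) by (metis length_inorder size_shape)
  then have "inorder l = inorder l'" "a = a'" "inorder r = inorder r'"
    using Node.prems(2) t'(1) by auto
  then show ?case using Node.IH t' by blast
qed

lemma ex_labelling:
  "length xs = size T \<Longrightarrow> \<exists>t. shape t = T \<and> inorder t = xs"
proof (induction T arbitrary: xs)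
  case Leaf
  then show ?case by (auto intro: exI[of _ Leaf])
next
  case (Node l a r)
  obtain l' where l': "shape l' = l" "inorder l' = take (size l) xs"
    using Node.IH(1)[of "take (size l) xs"] Node.prems by auto
  obtain r' where r': "shape r' = r" "inorder r' = drop (Suc (size l)) xs"
    using Node.IH(2)[of "drop (Suc (size l)) xs"] Node.prems by auto
  have "inorder (Node l' (xs ! size l) r') = xs"
    using l' r' Node.prems by (simp add: id_take_nth_drop[symmetric])
  then show ?case using l' r' by (intro exI[of _ "Node l' (xs ! size l) r'"]) auto
qed

lemma set_rl_postfix [simp]: "set (rl_postfix t) = set_tree t"
  by (induction t) auto

lemma length_rl_postfix [simp]: "length (rl_postfix t) = size t"
  by (induction t) auto

lemma distinct_rl_postfix: "bst t \<Longrightarrow> distinct (rl_postfix t)"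
  for t :: "'a::linorder tree"
  by (induction t) fastforce+

lemma bst_of_Nil [simp]: "bst_of [] = Leaf"
  by (simp add: bst_of_def)

text \<open>The last letter is inserted first and becomes the root; every earlier letter goes to one
  side of it, in unchanged relative order. This recursion from the right end drives the later
  inductions on word length.\<close>

lemma bst_of_snoc:
  "bst_of (w @ [x]) = Node (bst_of (filter (\<lambda>y. y \<le> x) w)) x (bst_of (filter (\<lambda>y. x < y) w))"
  by (induction w) (auto simp: bst_of_def)

lemma set_bst_insert [simp]: "set_tree (bst_insert x t) = insert x (set_tree t)"
  by (induction t) auto

lemma size_bst_insert [simp]: "size (bst_insert x t) = Suc (size t)"
  by (induction t) auto

lemma bst_bst_insert: "bst t \<Longrightarrow> x \<notin> set_tree t \<Longrightarrow> bst (bst_insert x t)"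
  by (induction t) auto

lemma set_bst_of [simp]: "set_tree (bst_of w) = set w"
  by (induction w) (auto simp: bst_of_def)

lemma size_bst_of [simp]: "size (bst_of w) = length w"
  by (induction w) (auto simp: bst_of_def)

lemma bst_bst_of: "distinct w \<Longrightarrow> bst (bst_of w)"
proof (induction w)
  case (Cons x w)
  then show ?case using set_bst_of[of w] bst_bst_insert[of "bst_of w" x] by (simp add: bst_of_def)
qed simp

text \<open>The root is read last, hence inserted first, and comparison with it separates the
  remaining letters into the two subtrees again.\<close>

lemma bst_of_rl_postfix: "bst t \<Longrightarrow> bst_of (rl_postfix t) = t"
proof (induction t)
  case (Node l a r)
  have "filter (\<lambda>y. y \<le> a) (rl_postfix r) = []" "filter (\<lambda>y. y \<le> a) (rl_postfix l) = rl_postfix l"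
    "filter (\<lambda>y. a < y) (rl_postfix r) = rl_postfix r" "filter (\<lambda>y. a < y) (rl_postfix l) = []"
    using Node.prems by (force simp: filter_empty_conv filter_id_conv)+
  then show ?case
    using Node bst_of_snoc[of "rl_postfix r @ rl_postfix l" a] by simp
qed simp

lemma inorder_bst_interval:
  assumes "bst t" "set_tree t = {a..<b::nat}"
  shows "inorder t = [a..<b]"
  using assms
  by (intro sorted_distinct_set_unique)
    (auto simp: bst_iff_sorted_wrt_less strict_sorted_iff)

section \<open>Canonical labellings and canonical words\<close>

lemma canonical_labelling_shape:
  assumes "bst t" "set_tree t = {1..size t}"
  shows "canonical_labelling (shape t) = t"
  unfolding canonical_labelling_def
proof (rule the_equality)
  fix t' :: "nat tree"
  assume t': "shape t' = shape t \<and> set_tree t' = {1..size (shape t)} \<and> bst t'"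
  then have "inorder t' = inorder t"
    using assms inorder_bst_interval[of _ 1 "Suc (size t)"]
    by (simp add: atLeastLessThanSuc_atLeastAtMost)
  then show "t' = t" using t' shape_inorder_inject by blast
qed (use assms in auto)

lemma canonical_labelling_props:
  shows shape_canonical_labelling: "shape (canonical_labelling T) = T"
    and bst_canonical_labelling: "bst (canonical_labelling T)"
    and inorder_canonical_labelling: "inorder (canonical_labelling T) = [1..<Suc (size T)]"
proof -
  obtain t where t: "shape t = T" "inorder t = [1..<Suc (size T)]"
    using ex_labelling[of "[1..<Suc (size T)]" T] by (auto simp del: upt_Suc)
  then have "set_tree t = {1..size t}"
    by (metis size_shape set_inorder set_upt atLeastLessThanSuc_atLeastAtMost)
  moreover have "bst t"
    using t by (simp only: bst_iff_sorted_wrt_less) (simp add: strict_sorted_iff del: upt_Suc)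
  ultimately have "canonical_labelling T = t"
    using canonical_labelling_shape t by blast
  then show "shape (canonical_labelling T) = T" "bst (canonical_labelling T)"
    "inorder (canonical_labelling T) = [1..<Suc (size T)]"
    using t \<open>bst t\<close> by auto
qed

lemma set_canonical_labelling: "set_tree (canonical_labelling T) = {1..size T}"
  by (metis inorder_canonical_labelling set_inorder set_upt atLeastLessThanSuc_atLeastAtMost)

lemma canonical_word_permutation: "canonical_word T \<in> permutations_of_set {1..size T}"
  unfolding permutations_of_set_def canonical_word_def
  by (simp add: set_canonical_labelling distinct_rl_postfix bst_canonical_labelling)

lemma shape_bst_of_canonical_word: "shape (bst_of (canonical_word T)) = T"
  by (simp add: canonical_word_def bst_of_rl_postfix bst_canonical_labelling
      shape_canonical_labelling)

lemma canonical_word_in_class: "canonical_word T \<in> sylvester_class T"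
  unfolding sylvester_class_def
  using canonical_word_permutation shape_bst_of_canonical_word by blast

lemma inj_canonical_word: "inj canonical_word"
  by (metis injI shape_bst_of_canonical_word)

lemma length_permutation: "\<sigma> \<in> permutations_of_set {1..n::nat} \<Longrightarrow> length \<sigma> = n"
  using length_finite_permutations_of_set by fastforce

text \<open>The greatest word of the sylvester class of \<open>w\<close>.\<close>

definition max_word :: "nat list \<Rightarrow> nat list" where
  "max_word w = rl_postfix (bst_of w)"

lemma max_word_Nil [simp]: "max_word [] = []"
  by (simp add: max_word_def)

lemma max_word_snoc:
  "max_word (w @ [x]) = max_word (filter (\<lambda>y. x < y) w) @ max_word (filter (\<lambda>y. y \<le> x) w) @ [x]"
  by (simp add: max_word_def bst_of_snoc)

lemma set_max_word [simp]: "set (max_word w) = set w"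
  by (simp add: max_word_def)

lemma length_max_word [simp]: "length (max_word w) = length w"
  by (simp add: max_word_def)

text \<open>The search tree of a permutation is already the canonical labelling of its shape. Unlike
  \<open>canonical_word\<close>, \<open>max_word\<close> also makes sense on factors over other
  letters, which the induction needs.\<close>

lemma canonical_word_shape_bst_of:
  assumes "\<sigma> \<in> permutations_of_set {1..n}"
  shows "canonical_word (shape (bst_of \<sigma>)) = max_word \<sigma>"
proof -
  have "canonical_labelling (shape (bst_of \<sigma>)) = bst_of \<sigma>"
    using assms by (intro canonical_labelling_shape)
      (auto simp: bst_bst_of length_permutation permutations_of_set_def distinct_card[symmetric])
  then show ?thesis by (simp add: canonical_word_def max_word_def)
qed

section \<open>Inverse permutations and decreasing trees\<close>

definition letter_position :: "nat list \<Rightarrow> nat \<Rightarrow> nat" where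
  "letter_position \<sigma> i = (THE k. k \<in> {1..length \<sigma>} \<and> \<sigma> ! (k - 1) = i)"

lemma letter_position_nth:
  assumes "distinct \<sigma>" "j < length \<sigma>"
  shows "letter_position \<sigma> (\<sigma> ! j) = Suc j"
  unfolding letter_position_def
proof (rule the_equality)
  fix k
  assume k: "k \<in> {1..length \<sigma>} \<and> \<sigma> ! (k - 1) = \<sigma> ! j"
  then have "k - 1 = j" using assms nth_eq_iff_index_eq[of \<sigma> "k - 1" j] by auto
  then show "k = Suc j" using k by auto
qed (use assms in auto)

lemma map_letter_position: "distinct \<sigma> \<Longrightarrow> map (letter_position \<sigma>) \<sigma> = [1..<Suc (length \<sigma>)]"
  by (rule nth_equalityI) (auto simp: letter_position_nth nth_upt simp del: upt_Suc)

lemma inv_perm_eq_map: "inv_perm \<sigma> = map (letter_position \<sigma>) [1..<Suc (length \<sigma>)]"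
  by (simp add: inv_perm_def letter_position_def)

lemma length_inv_perm [simp]: "length (inv_perm \<sigma>) = length \<sigma>"
  by (simp add: inv_perm_def del: upt_Suc)

lemma letter_position_image:
  assumes "\<sigma> \<in> permutations_of_set {1..n}"
  shows "letter_position \<sigma> ` {1..n} = {1..n}"
proof -
  have "letter_position \<sigma> ` set \<sigma> = set [1..<Suc (length \<sigma>)]"
    using assms by (metis list.set_map map_letter_position permutations_of_setD(2))
  then show ?thesis
    using assms by (simp add: length_permutation atLeastLessThanSuc_atLeastAtMost
        permutations_of_setD(1) del: upt_Suc)
qed

lemma inj_letter_position:
  assumes "\<sigma> \<in> permutations_of_set {1..n}"
  shows "inj_on (letter_position \<sigma>) {1..n}"
  using letter_position_image[OF assms] by (simp add: eq_card_imp_inj_on)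

lemma inv_perm_permutation:
  assumes "\<sigma> \<in> permutations_of_set {1..n}"
  shows "inv_perm \<sigma> \<in> permutations_of_set {1..n}"
  using letter_position_image[OF assms] inj_letter_position[OF assms]
  by (simp add: permutations_of_set_def inv_perm_eq_map length_permutation[OF assms] distinct_map
      atLeastLessThanSuc_atLeastAtMost del: upt_Suc)

lemma inv_perm_inject:
  assumes \<sigma>: "\<sigma> \<in> permutations_of_set {1..n}" and \<tau>: "\<tau> \<in> permutations_of_set {1..m}"
    and eq: "inv_perm \<sigma> = inv_perm \<tau>"
  shows "\<sigma> = \<tau>"
proof -
  have [simp]: "m = n" "length \<sigma> = n" "length \<tau> = n"
    using length_permutation[OF \<sigma>] length_permutation[OF \<tau>] arg_cong[OF eq, of length] by auto
  have pos: "letter_position \<sigma> i = letter_position \<tau> i" if "i \<in> {1..n}" for i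
    using eq that by (auto simp: inv_perm_eq_map simp del: upt_Suc)
  show ?thesis
  proof (rule nth_equalityI)
    fix j assume "j < length \<sigma>"
    then have j: "j < n" by simp
    have mem: "\<sigma> ! j \<in> {1..n}" "\<tau> ! j \<in> {1..n}"
      using j \<sigma> \<tau> by (metis \<open>length \<sigma> = n\<close> \<open>length \<tau> = n\<close> \<open>m = n\<close> nth_mem permutations_of_setD(1))+
    have "letter_position \<sigma> (\<sigma> ! j) = Suc j" "letter_position \<tau> (\<tau> ! j) = Suc j"
      using j \<sigma> \<tau> by (auto intro!: letter_position_nth dest: permutations_of_setD(2))
    then show "\<sigma> ! j = \<tau> ! j"
      using pos[OF mem(2)] inj_onD[OF inj_letter_position[OF \<sigma>] _ mem] by simp
  qed simp
qed

section \<open>Decreasing trees of inverse permutations\<close>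

inductive decreasing_tree :: "nat list \<Rightarrow> unit tree \<Rightarrow> bool" where
  Nil: "decreasing_tree [] Leaf"
| split: "\<forall>x \<in> set L \<union> set R. x < m \<Longrightarrow> decreasing_tree L l \<Longrightarrow> decreasing_tree R r
    \<Longrightarrow> decreasing_tree (L @ m # R) (Node l () r)"

inductive avoiding_decreasing_tree :: "nat list \<Rightarrow> unit tree \<Rightarrow> bool" where
  Nil: "avoiding_decreasing_tree [] Leaf"
| split: "\<forall>x \<in> set L \<union> set R. x < m \<Longrightarrow> \<forall>x \<in> set L. \<forall>y \<in> set R. y < x
    \<Longrightarrow> avoiding_decreasing_tree L l \<Longrightarrow> avoiding_decreasing_tree R r
    \<Longrightarrow> avoiding_decreasing_tree (L @ m # R) (Node l () r)"

lemma avoiding_imp_decreasing_tree: "avoiding_decreasing_tree u T \<Longrightarrow> decreasing_tree u T"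
  by (induction rule: avoiding_decreasing_tree.induct) (auto intro: decreasing_tree.intros)

lemma decreasing_tree_length: "decreasing_tree w T \<Longrightarrow> length w = size T"
  by (induction rule: decreasing_tree.induct) auto

lemma decreasing_tree_map:
  "decreasing_tree w T \<Longrightarrow> strict_mono_on (set w) f \<Longrightarrow> decreasing_tree (map f w) T"
proof (induction rule: decreasing_tree.induct)
  case (split L R m l r)
  have "strict_mono_on (set L) f" "strict_mono_on (set R) f"
    using split.prems by (auto intro: monotone_on_subset)
  moreover have "\<forall>x \<in> set (map f L) \<union> set (map f R). x < f m"
    using split.hyps(1) split.prems by (auto dest: strict_mono_onD)
  ultimately show ?case
    using split.IH by (auto intro: decreasing_tree.split)
qed (simp add: decreasing_tree.Nil)

text \<open>Think of \<open>t\<close> as the time at which a letter of \<open>w\<close> is read. The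
  root is the last letter, so its time is the maximum at which the inorder sequence of times splits.
  For a permutation and \<open>t = letter_position\<close>, that sequence is the inverse;
  \<open>t\<close> is arbitrary because the times of a subword need not be consecutive.\<close>

lemma decreasing_tree_bst_of:
  "sorted_wrt (<) (map t w) \<Longrightarrow> decreasing_tree (map t (inorder (bst_of w))) (shape (bst_of w))"
proof (induction "length w" arbitrary: w rule: less_induct)
  case less
  show ?case
  proof (cases w rule: rev_cases)
    case (snoc v x)
    let ?L = "filter (\<lambda>y. y \<le> x) v" and ?R = "filter (\<lambda>y. x < y) v"
    have *: "sorted_wrt (\<lambda>x y. t x < t y) v" "\<forall>y \<in> set v. t y < t x"
      using less.prems snoc by (auto simp: sorted_wrt_map sorted_wrt_append)
    have "length ?L < length w" "length ?R < length w"
      using snoc by (simp_all add: le_imp_less_Suc)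
    moreover have "sorted_wrt (<) (map t ?L)" "sorted_wrt (<) (map t ?R)"
      using *(1) by (simp_all add: sorted_wrt_map sorted_wrt_filter)
    ultimately show ?thesis
      using less.hyps[of ?L] less.hyps[of ?R] *(2) snoc
      by (auto simp: bst_of_snoc intro!: decreasing_tree.split)
  qed (simp add: decreasing_tree.Nil)
qed

text \<open>The postfix reading visits right subtree, left subtree, root; so times increasing along
  it are larger on the left than on the right, and largest at the root.\<close>

lemma avoiding_decreasing_tree_inorder:
  "sorted_wrt (<) (map t (rl_postfix T)) \<Longrightarrow> avoiding_decreasing_tree (map t (inorder T)) (shape T)"
  by (induction T)
    (auto simp: sorted_wrt_append simp del: map_map intro!: avoiding_decreasing_tree.intros)

lemma sorted_map_letter_position: "distinct \<sigma> \<Longrightarrow> sorted_wrt (<) (map (letter_position \<sigma>) \<sigma>)"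
  by (simp add: map_letter_position strict_sorted_iff del: upt_Suc)

lemma decreasing_tree_inv_perm:
  assumes "\<sigma> \<in> permutations_of_set {1..n}"
  shows "decreasing_tree (inv_perm \<sigma>) (shape (bst_of \<sigma>))"
proof -
  have "set_tree (bst_of \<sigma>) = {1..<Suc (length \<sigma>)}"
    using permutations_of_setD(1)[OF assms] length_permutation[OF assms]
    by (simp add: atLeastLessThanSuc_atLeastAtMost)
  then have "inorder (bst_of \<sigma>) = [1..<Suc (length \<sigma>)]"
    using inorder_bst_interval bst_bst_of permutations_of_setD(2)[OF assms] by blast
  then show ?thesis
    using decreasing_tree_bst_of[OF sorted_map_letter_position] assms
    by (metis inv_perm_eq_map permutations_of_setD(2))
qed

lemma avoiding_decreasing_tree_inv_canonical_word:
  "avoiding_decreasing_tree (inv_perm (canonical_word T)) T"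
proof -
  let ?w = "canonical_word T"
  have "distinct ?w" "length ?w = size T"
    using canonical_word_permutation[of T] length_permutation permutations_of_setD(2) by blast+
  then show ?thesis
    using avoiding_decreasing_tree_inorder[of "letter_position ?w" "canonical_labelling T"]
      sorted_map_letter_position[of ?w]
    by (simp add: inv_perm_eq_map canonical_word_def[symmetric] shape_canonical_labelling
        inorder_canonical_labelling del: upt_Suc)
qed

section \<open>Lexicographic comparison\<close>

text \<open>Unlike the library's lexicographic order, neither relation makes a proper prefix
  smaller: it is incomparable for \<open>lex_less\<close> and \<^emph>\<open>greater\<close> for \<open>lex_ge\<close>, as if every word
  were followed by an infinite letter.\<close>

fun lex_less :: "nat list \<Rightarrow> nat list \<Rightarrow> bool" where
  "lex_less (x # xs) (y # ys) \<longleftrightarrow> x < y \<or> x = y \<and> lex_less xs ys"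
| "lex_less _ _ \<longleftrightarrow> False"

fun lex_ge :: "nat list \<Rightarrow> nat list \<Rightarrow> bool" where
  "lex_ge [] _ \<longleftrightarrow> True"
| "lex_ge (x # xs) [] \<longleftrightarrow> False"
| "lex_ge (x # xs) (y # ys) \<longleftrightarrow> y < x \<or> x = y \<and> lex_ge xs ys"

lemma lex_less_imp_lexord: "lex_less xs ys \<Longrightarrow> (xs, ys) \<in> lexord less_than"
  by (induction xs ys rule: lex_less.induct) auto

lemma lex_less_append: "lex_less xs ys \<Longrightarrow> lex_less (xs @ us) (ys @ vs)"
  by (induction xs ys rule: lex_less.induct) auto

lemma lex_less_append_left [simp]: "lex_less (xs @ us) (xs @ vs) \<longleftrightarrow> lex_less us vs"
  by (induction xs) auto

lemma lex_less_trans: "lex_less xs ys \<Longrightarrow> lex_less ys zs \<Longrightarrow> lex_less xs zs"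
proof (induction xs ys arbitrary: zs rule: lex_less.induct)
  case (1 x xs y ys)
  then show ?case by (cases zs) auto
qed auto

lemma lex_ge_append_left [simp]: "lex_ge (xs @ us) (xs @ vs) \<longleftrightarrow> lex_ge us vs"
  by (induction xs) auto

lemma lex_ge_append_right: "lex_ge xs ys \<Longrightarrow> lex_ge xs (ys @ zs)"
  by (induction xs ys rule: lex_ge.induct) auto

text \<open>The final \<open>m\<close> stands for the infinite letter implicit in
  \<open>lex_ge\<close>: if \<open>xs\<close> is a proper prefix of \<open>ys\<close>, then
  \<open>m\<close> beats the next letter of \<open>ys\<close>.\<close>

lemma lex_ge_snoc:
  "lex_ge xs ys \<Longrightarrow> \<forall>y \<in> set ys. y < m \<Longrightarrow> lex_ge (xs @ [m]) (ys @ [m])"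
proof (induction xs ys rule: lex_ge.induct)
  case (1 ys)
  then show ?case by (cases ys) auto
qed auto

lemma lex_ge_map:
  "lex_ge xs ys \<Longrightarrow> strict_mono_on A f \<Longrightarrow> set xs \<subseteq> A \<Longrightarrow> set ys \<subseteq> A
    \<Longrightarrow> lex_ge (map f xs) (map f ys)"
  by (induction xs ys rule: lex_ge.induct) (auto dest: strict_mono_onD)

text \<open>The shorter word \<open>xs\<close> either wins at the first difference or is a proper
  prefix of \<open>ys\<close>, and then \<open>m\<close> meets a smaller letter.\<close>

lemma lex_less_of_lex_ge:
  "lex_ge xs ys \<Longrightarrow> length xs < length ys \<Longrightarrow> \<forall>y \<in> set ys. y < m
    \<Longrightarrow> lex_less ys (xs @ m # zs)"
proof (induction xs ys rule: lex_ge.induct)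
  case (1 ys)
  then show ?case by (cases ys) auto
qed auto

section \<open>Greatest words of sylvester classes\<close>

text \<open>Insertion sees letters only through comparisons.\<close>

lemma max_word_map:
  "strict_mono_on (set w) f \<Longrightarrow> max_word (map f w) = map f (max_word w)"
proof (induction "length w" arbitrary: w rule: less_induct)
  case less
  show ?case
  proof (cases w rule: rev_cases)
    case (snoc v x)
    let ?L = "filter (\<lambda>y. y \<le> x) v" and ?R = "filter (\<lambda>y. x < y) v"
    have "length ?L < length w" "length ?R < length w"
      using snoc by (simp_all add: le_imp_less_Suc)
    moreover have "strict_mono_on (set ?L) f" "strict_mono_on (set ?R) f"
      using less.prems snoc by (auto intro: monotone_on_subset)
    moreover have "filter (\<lambda>y. y \<le> f x) (map f v) = map f ?L"
      "filter (\<lambda>y. f x < y) (map f v) = map f ?R"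
      using less.prems snoc
      by (auto simp: filter_map strict_mono_on_less strict_mono_on_less_eq
          intro!: arg_cong[of _ _ "map f"] filter_cong)
    ultimately show ?thesis
      using less.hyps[of ?L] less.hyps[of ?R] snoc by (simp add: max_word_snoc)
  qed simp
qed

text \<open>Consider the last letter \<open>x\<close>. If \<open>x\<close> is kept, so is everything
  above it: the right subtree, read first, is unchanged, and induction applies to the left one. If
  \<open>x\<close> is dropped, so is everything below it, and the comparison is decided within the
  right subtree.\<close>

lemma max_word_filter_lex_ge:
  assumes "distinct w" "\<And>x y. P x \<Longrightarrow> x \<le> y \<Longrightarrow> P y"
  shows "lex_ge (max_word (filter P w)) (max_word w)"
  using assms(1)
proof (induction "length w" arbitrary: w rule: less_induct)
  case less
  show ?case
  proof (cases w rule: rev_cases)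
    case (snoc v x)
    let ?L = "filter (\<lambda>y. y \<le> x) v" and ?R = "filter (\<lambda>y. x < y) v"
    have len: "length ?L < length w" "length ?R < length w"
      using snoc by (simp_all add: le_imp_less_Suc)
    have dist: "distinct ?L" "distinct ?R" using less.prems snoc by auto
    show ?thesis
    proof (cases "P x")
      case True
      have R: "filter (\<lambda>y. x < y) (filter P v) = ?R"
        using True assms(2) by (auto intro!: filter_cong)
      have L: "filter (\<lambda>y. y \<le> x) (filter P v) = filter P ?L"
        by (auto intro!: filter_cong)
      have "\<forall>y \<in> set (max_word ?L). y < x"
        using less.prems snoc by (auto simp: le_less)
      then have "lex_ge (max_word (filter P ?L) @ [x]) (max_word ?L @ [x])"
        using less.hyps[OF len(1) dist(1)] lex_ge_snoc by blast
      then show ?thesis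
        using snoc True by (simp add: max_word_snoc R L del: filter_filter)
    next
      case False
      then have "filter P v = filter P ?R"
        using assms(2) by (auto intro!: filter_cong) (meson not_less)
      then show ?thesis
        using snoc False less.hyps[OF len(2) dist(2)]
        by (simp add: max_word_snoc lex_ge_append_right del: filter_filter)
    qed
  qed simp
qed

text \<open>In the search tree of \<open>L @ m # R\<close> the left subtree of the maximum \<open>m\<close> consists of the
  letters of \<open>L\<close> exceeding all of \<open>R\<close>, and \<open>m\<close> lies on the right spine.\<close>

lemma max_word_split:
  assumes "\<forall>x \<in> set L \<union> set R. x < m"
  shows "max_word (L @ m # R) = max_word (filter (\<lambda>x. \<forall>y \<in> set R. y < x) L) @ m #
    max_word (filter (\<lambda>x. \<not> (\<forall>y \<in> set R. y < x)) L @ R)"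
  using assms
proof (induction "length R" arbitrary: L R rule: less_induct)
  case less
  show ?case
  proof (cases R rule: rev_cases)
    case Nil
    have "filter (\<lambda>y. m < y) L = []" "filter (\<lambda>y. y \<le> m) L = L"
      using less.prems by (auto simp: filter_empty_conv filter_id_conv dest!: bspec)
    then show ?thesis using Nil max_word_snoc[of L m] by simp
  next
    case (snoc S x)
    let ?U = "\<lambda>z. \<forall>y \<in> set R. y < z" and ?S = "filter (\<lambda>y. x < y) S"
      and ?L = "filter (\<lambda>y. x < y) L"
    have len: "length ?S < length R" using snoc by (simp add: le_imp_less_Suc)
    have x: "x < m" using less.prems snoc by auto
    \<comment> \<open>The root is \<open>x < m\<close>, so \<open>m\<close> lies in its right
      subtree and the induction hypothesis applies to the letters above \<open>x\<close>. There,
      exceeding \<open>?S\<close> amounts to exceeding all of \<open>R\<close>, since the letters of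
      \<open>S\<close> outside \<open>?S\<close> are at most \<open>x\<close>.\<close>
    have U: "filter (\<lambda>z. \<forall>y \<in> set ?S. y < z) ?L = filter ?U L"
      using snoc by (auto intro!: filter_cong)
    have V: "filter (\<lambda>z. \<not> (\<forall>y \<in> set ?S. y < z)) ?L = filter (\<lambda>y. x < y) (filter (\<lambda>z. \<not> ?U z) L)"
      using snoc by (auto intro!: filter_cong)
    have W: "filter (\<lambda>y. y \<le> x) (filter (\<lambda>z. \<not> ?U z) L) = filter (\<lambda>y. y \<le> x) L"
      using snoc by (auto intro!: filter_cong)
    have "max_word (L @ m # R) = max_word (?L @ m # ?S) @
        max_word (filter (\<lambda>y. y \<le> x) L @ filter (\<lambda>y. y \<le> x) S) @ [x]"
      using x snoc max_word_snoc[of "L @ m # S" x] by simp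
    also have "max_word (?L @ m # ?S) = max_word (filter ?U L) @ m #
        max_word (filter (\<lambda>y. x < y) (filter (\<lambda>z. \<not> ?U z) L) @ ?S)"
      using less.hyps[OF len, of ?L] less.prems snoc unfolding U V by auto
    also have "max_word (filter (\<lambda>y. y \<le> x) L @ filter (\<lambda>y. y \<le> x) S) =
        max_word (filter (\<lambda>y. y \<le> x) (filter (\<lambda>z. \<not> ?U z) L @ S))"
      by (simp only: W filter_append)
    finally show ?thesis
      using max_word_snoc[of "filter (\<lambda>z. \<not> ?U z) L @ S" x]
      by (simp only: snoc append_assoc append_Cons filter_append)
  qed
qed

text \<open>The upper part of an interval is determined by its cardinality. Hence left factors of
  equal length, each lying above its right factor, have the same letters.\<close>

lemma interval_split:
  fixes A B :: "nat set"
  assumes un: "A \<union> B = {a..<b}" and less: "\<forall>x \<in> A. \<forall>y \<in> B. y < x"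
  shows "A = {b - card A..<b}" "B = {a..<b - card A}"
proof -
  have "A = {b - card A..<b} \<and> B = {a..<b - card A}"
  proof (cases "A = {}")
    case False
    have fin: "finite A" using un by (metis finite_Un finite_atLeastLessThan)
    define c where "c = Min A"
    have c: "c \<in> A" "\<And>x. x \<in> A \<Longrightarrow> c \<le> x"
      using False fin by (auto simp: c_def)
    have A: "A = {c..<b}"
    proof (intro set_eqI iffI)
      fix x assume "x \<in> {c..<b}"
      moreover have "a \<le> c" using c(1) un by auto
      ultimately have "x \<in> A \<union> B" "c \<le> x" using un by auto
      then show "x \<in> A" using less c(1) by fastforce
    next
      fix x assume "x \<in> A"
      then show "x \<in> {c..<b}" using c(2) un by auto
    qed
    have "c < b" using c(1) A by simp
    then have "b - card A = c" using A by simp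
    moreover have "B = {a..<c}"
    proof (intro set_eqI iffI)
      fix x assume "x \<in> B"
      then show "x \<in> {a..<c}" using less c(1) un by auto
    next
      fix x assume "x \<in> {a..<c}"
      then have "x \<in> A \<union> B" "x < c" using un \<open>c < b\<close> by auto
      then show "x \<in> B" using c(2) by fastforce
    qed
    ultimately show ?thesis using A by simp
  qed (use un in simp)
  then show "A = {b - card A..<b}" "B = {a..<b - card A}" by blast+
qed

text \<open>The k-th largest element of \<open>A\<close> is sent to \<open>b - k\<close>. An
  \<open>x\<close> with no gap of \<open>A\<close> between it and \<open>b\<close> is therefore
  fixed.\<close>

lemma ex_relabelling_to_top:
  fixes A :: "nat set"
  assumes A: "A \<subseteq> {..<b}"
  obtains f where "strict_mono_on A f" "f ` A = {b - card A..<b}"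
    "\<And>x. {x..<b} \<subseteq> A \<Longrightarrow> x < b \<Longrightarrow> f x = x"
proof
  let ?up = "\<lambda>x. {y \<in> A. x \<le> y}"
  define f where "f = (\<lambda>x. b - card (?up x))"
  have fin: "finite A" using A finite_subset by blast
  have cardA: "card A \<le> b" using card_mono[OF _ A] by simp
  have le: "card (?up x) \<le> card A" for x
    by (intro card_mono fin) auto
  show mono: "strict_mono_on A f"
  proof (rule strict_mono_onI)
    fix x y assume xy: "x \<in> A" "y \<in> A" "x < y"
    then have "card (?up y) < card (?up x)"
      by (intro psubset_card_mono psubsetI subsetI) (use fin in \<open>auto dest: leD\<close>)
    then show "f x < f y" using le[of x] cardA by (simp add: f_def)
  qed
  have "f x \<in> {b - card A..<b}" if "x \<in> A" for x
  proof -
    have "0 < card (?up x)" using that fin by (auto simp: card_gt_0_iff)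
    then show ?thesis using le[of x] cardA by (auto simp: f_def)
  qed
  then have "f ` A \<subseteq> {b - card A..<b}" by blast
  moreover have "card (f ` A) = card {b - card A..<b}"
    using mono cardA by (simp add: card_image strict_mono_on_imp_inj_on)
  ultimately show "f ` A = {b - card A..<b}"
    by (intro card_subset_eq) auto
  show "f x = x" if "{x..<b} \<subseteq> A" "x < b" for x
  proof -
    have "?up x = {x..<b}" using that A by auto
    then show ?thesis using that by (simp add: f_def)
  qed
qed

text \<open>Stated for words on a common interval rather than for permutations, so that the
  induction can pass to the factors around the maximum.\<close>

lemma max_word_decreasing_tree:
  assumes "avoiding_decreasing_tree u T" "decreasing_tree w T"
    and "set u = {a..<b}" "set w = {a..<b}" "distinct u" "distinct w"
  shows "if w = u then max_word w = u else lex_less u (max_word w)"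
  using assms
proof (induction arbitrary: w a b rule: avoiding_decreasing_tree.induct)
  case Nil
  then show ?case by simp
next
  case (split L' R' m l r)
  from split.prems(1) obtain L m' R where w: "w = L @ m' # R"
    and m': "\<forall>x \<in> set L \<union> set R. x < m'" and dec: "decreasing_tree L l" "decreasing_tree R r"
    by (auto elim: decreasing_tree.cases)
  have len: "length L = length L'" "length R = length R'"
    using dec split.hyps(3,4) decreasing_tree_length avoiding_imp_decreasing_tree by metis+
  have "set w = set (L' @ m # R')" using split.prems(2,3) by simp
  then have "m' = m"
    using m' split.hyps(1) w by (metis Un_iff in_set_conv_decomp less_asym' set_ConsD set_append)
  note w = w[unfolded this] and m = m'[unfolded this]
  \<comment> \<open>As \<open>m\<close> is the largest letter, removing it leaves the interval from
    \<open>a\<close> to \<open>m - 1\<close> to the two factors of either word.\<close>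
  have "b = Suc m"
  proof (rule ccontr)
    assume "b \<noteq> Suc m"
    moreover have "m \<in> {a..<b}" using split.prems(2) by auto
    ultimately have "Suc m \<in> set (L' @ m # R')" using split.prems(2) by auto
    then show False using split.hyps(1) by (auto dest!: bspec)
  qed
  have un': "set L' \<union> set R' = {a..<m}"
    using split.prems(2,4) split.hyps(1) \<open>b = Suc m\<close> by auto
  have un: "set L \<union> set R = {a..<m}"
    using split.prems(3,5) m w \<open>b = Suc m\<close> by auto
  have dist: "distinct L" "distinct R" "distinct L'" "distinct R'" "set L \<inter> set R = {}"
    using split.prems(4,5) w by auto
  have card: "card (set L) = length L'" "card (set L') = length L'"
    using dist len by (auto simp: distinct_card)
  note L' = interval_split[OF un' split.hyps(2), unfolded card]
  let ?U = "filter (\<lambda>x. \<forall>y \<in> set R. y < x) L"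
  note max = max_word_split[OF m, folded w]
  show ?case
  proof (cases "\<forall>x \<in> set L. \<forall>y \<in> set R. y < x")
    case True
    \<comment> \<open>Now \<open>L\<close> and \<open>L'\<close> have the same letters, as do
      \<open>R\<close> and \<open>R'\<close>, so both induction hypotheses apply directly.\<close>
    note L = interval_split[OF un True, unfolded card]
    have "?U = L" "filter (\<lambda>x. \<not> (\<forall>y \<in> set R. y < x)) L = []"
      using True by (auto simp: filter_id_conv filter_empty_conv)
    then have max': "max_word w = max_word L @ m # max_word R" using max by simp
    have IH: "if L = L' then max_word L = L' else lex_less L' (max_word L)"
      "if R = R' then max_word R = R' else lex_less R' (max_word R)"
      by (rule split.IH(1)[OF dec(1) L'(1) L(1) dist(3,1)],
          rule split.IH(2)[OF dec(2) L'(2) L(2) dist(4,2)])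
    show ?thesis
    proof (cases "L = L'")
      case True
      then show ?thesis using IH max' w by (auto split: if_splits)
    next
      case False
      then show ?thesis using IH max' w len lex_less_append[of L' "max_word L"] by auto
    qed
  next
    case False
    \<comment> \<open>Here \<open>L\<close> and \<open>L'\<close> may have different letters. Moving
      those of \<open>L\<close> up to those of \<open>L'\<close> makes the induction hypothesis
      applicable to \<open>map f L\<close>, while the letters of \<open>?U\<close>, already on top,
      stay fixed. Thus \<open>L'\<close> is at most \<open>max_word (map f L)\<close>, which is
      below \<open>max_word w\<close>.\<close>
    have "set L \<subseteq> {..<m}" using m by auto
    then obtain f where f: "strict_mono_on (set L) f" "f ` set L = {m - length L'..<m}"
      "\<And>x. {x..<m} \<subseteq> set L \<Longrightarrow> x < m \<Longrightarrow> f x = x"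
      using ex_relabelling_to_top card(1) by metis
    have "f x = x" if "x \<in> set ?U" for x
    proof (rule f(3))
      have x: "x \<in> set L" "\<forall>y \<in> set R. y < x" using that by auto
      show "x < m" using x m by blast
      show "{x..<m} \<subseteq> set L"
      proof
        fix y assume "y \<in> {x..<m}"
        moreover have "a \<le> x" using x(1) un by auto
        ultimately have "y \<in> set L \<union> set R" "\<not> y < x" using un by auto
        then show "y \<in> set L" using x(2) by blast
      qed
    qed
    then have fU: "map f (max_word ?U) = max_word ?U"
      by (intro map_idI) auto
    have "lex_ge (max_word ?U) (max_word L)"
      by (rule max_word_filter_lex_ge) (use dist in auto)
    then have "lex_ge (map f (max_word ?U)) (map f (max_word L))"
      by (rule lex_ge_map[OF _ f(1)]) auto
    then have ge: "lex_ge (max_word ?U) (max_word (map f L))"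
      using fU max_word_map[OF f(1)] by simp
    have "length ?U < length L"
      using False by (auto intro: length_filter_less)
    then have less: "lex_less (max_word (map f L)) (max_word w)"
      unfolding max using f(2) by (intro lex_less_of_lex_ge[OF ge]) auto
    have "if map f L = L' then max_word (map f L) = L' else lex_less L' (max_word (map f L))"
      using f L' dist dec(1)
      by (intro split.IH(1)[of _ "m - length L'" m])
        (auto simp: decreasing_tree_map distinct_map strict_mono_on_imp_inj_on)
    then have "lex_less L' (max_word w)"
      using less lex_less_trans by (auto split: if_splits)
    then have *: "lex_less (L' @ m # R') (max_word w)"
      using lex_less_append[of L' "max_word w" "m # R'" "[]"] by simp
    have "w \<noteq> L' @ m # R'"
      using False split.hyps(2) w len by auto
    then show ?thesis using * by simp
  qed
qed

text \<open>The inverses of the words in the class all have decreasing tree \<open>T\<close>, and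
  \<open>u\<close> is the one among them avoiding 132.\<close>

lemma inverse_class_comparison:
  assumes "\<sigma> \<in> sylvester_class T"
  defines "u \<equiv> inv_perm (canonical_word T)"
    and "v \<equiv> canonical_word (shape (bst_of (inv_perm \<sigma>)))"
  shows "if \<sigma> = canonical_word T then v = u else (u, v) \<in> lexord less_than"
proof -
  have \<sigma>: "\<sigma> \<in> permutations_of_set {1..size T}" "shape (bst_of \<sigma>) = T"
    using assms(1) by (auto simp: sylvester_class_def)
  note perms = \<sigma>(1) canonical_word_permutation[of T]
  note inv = perms[THEN inv_perm_permutation]
  have "decreasing_tree (inv_perm \<sigma>) T"
    using decreasing_tree_inv_perm[OF \<sigma>(1)] \<sigma>(2) by simp
  then have "if inv_perm \<sigma> = u then max_word (inv_perm \<sigma>) = u else lex_less u (max_word (inv_perm \<sigma>))"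
    using inv[THEN permutations_of_setD(1)] inv[THEN permutations_of_setD(2)]
    unfolding u_def
    by (intro max_word_decreasing_tree[OF avoiding_decreasing_tree_inv_canonical_word,
          of _ _ 1 "Suc (size T)"]) (simp_all add: atLeastLessThanSuc_atLeastAtMost)
  moreover have "v = max_word (inv_perm \<sigma>)"
    unfolding v_def by (rule canonical_word_shape_bst_of[OF inv(1)])
  moreover have "inv_perm \<sigma> = u \<longleftrightarrow> \<sigma> = canonical_word T"
    unfolding u_def using inv_perm_inject[OF perms] by blast
  ultimately show ?thesis
    by (auto simp: lex_less_imp_lexord split: if_splits)
qed

section \<open>Dual bases and unitriangular families\<close>

lemma sum_fun_apply: "(\<Sum>i\<in>A. f i) x = (\<Sum>i\<in>A. f i x)"
  for f :: "'i \<Rightarrow> 'x \<Rightarrow> 'k::comm_monoid_add"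
  by (induction A rule: infinite_finite_induct) auto

lemma sum_mset_fun_apply: "(\<Sum>i\<in>#M. f i) x = (\<Sum>i\<in>#M. f i x)"
  for f :: "'i \<Rightarrow> 'x \<Rightarrow> 'k::comm_monoid_add"
  by (induction M) auto

lemma fscale_apply [simp]: "fscale c f x = c * f x"
  by (simp add: fscale_def)

lemma sum_mset_in_span:
  "(\<And>i. i \<in># M \<Longrightarrow> f i \<in> fs.span S) \<Longrightarrow> (\<Sum>i\<in>#M. f i) \<in> fs.span S"
  by (induction M) (auto intro: fs.span_add fs.span_zero)

text \<open>The vectors are functions, so evaluation at \<open>p j\<close> extracts the coefficient
  of \<open>B j\<close>. The bijection \<open>g\<close> gives the leading index of each
  \<open>B' i\<close>; all other indices lie above it in \<open>R\<close>.\<close>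

lemma unitriangular_is_basis:
  fixes B B' :: "'i \<Rightarrow> 'x \<Rightarrow> 'k::field"
  assumes dual: "\<And>i j. B i (p j) = (if i = j then 1 else 0)"
    and span: "fs.span (range B) = V"
    and g: "bij g"
    and B': "\<And>i. B' i = B (g i) + (\<Sum>j\<in>#M i. B j)"
    and M: "\<And>i j. j \<in># M i \<Longrightarrow> R (g i) j"
    and R: "asymp R" "transp R"
    and fin: "\<And>i. finite {j. R i j}"
  shows "is_basis B' V"
proof -
  have off: "B' i (p k) = 0" if "k \<noteq> g i" "\<not> R (g i) k" for i k
  proof -
    have "(\<Sum>j\<in>#M i. B j (p k)) = (\<Sum>j\<in>#M i. 0)"
      using that M by (intro arg_cong[of _ _ sum_mset] image_mset_cong) (auto simp: dual)
    then show ?thesis using that by (simp add: B' sum_mset_fun_apply dual)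
  qed
  have diag: "B' i (p (g i)) = 1" for i
  proof -
    have "(\<Sum>j\<in>#M i. B j (p (g i))) = (\<Sum>j\<in>#M i. 0)"
      using M R(1) by (intro arg_cong[of _ _ sum_mset] image_mset_cong) (auto simp: dual dest: asympD)
    then show ?thesis by (simp add: B' sum_mset_fun_apply dual)
  qed
  have inj: "inj B'"
  proof (rule injI)
    fix i j assume eq: "B' i = B' j"
    have "g i = g j"
    proof (rule ccontr)
      assume ne: "g i \<noteq> g j"
      have "R (g j) (g i)" using off[of "g i" j] diag[of i] eq ne by auto
      moreover have "R (g i) (g j)" using off[of "g j" i] diag[of j] eq ne by auto
      ultimately show False using R(1) by (auto dest: asympD)
    qed
    then show "i = j" using g by (auto simp: bij_def dest: injD)
  qed
  have "fs.independent (range B')"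
    unfolding fs.dependent_explicit
  proof (intro notI, elim exE conjE bexE)
    fix t u v
    assume t: "finite t" "t \<subseteq> range B'" "(\<Sum>v\<in>t. fscale (u v) v) = 0" and v: "v \<in> t" "u v \<noteq> 0"
    \<comment> \<open>Among the indices occurring in the relation, take one whose leading index is
      minimal; evaluation at \<open>p (g i)\<close> then kills every other summand.\<close>
    define I where "I = {i. B' i \<in> t \<and> u (B' i) \<noteq> 0}"
    have "finite (B' -` t)" using t(1) inj by (rule finite_vimageI)
    then have "finite I" by (rule rev_finite_subset) (auto simp: I_def)
    moreover have "I \<noteq> {}" using v t(2) by (auto simp: I_def)
    moreover have "asymp_on I (\<lambda>i j. R (g i) (g j))" "transp_on I (\<lambda>i j. R (g i) (g j))"
      using R by (auto intro!: asymp_onI transp_onI dest: asympD transpD)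
    ultimately obtain i where i: "i \<in> I" "\<And>j. j \<in> I \<Longrightarrow> j \<noteq> i \<Longrightarrow> \<not> R (g j) (g i)"
      using Finite_Set.bex_min_element by (metis (no_types, lifting))
    have "u v * v (p (g i)) = 0" if "v \<in> t - {B' i}" for v
    proof (cases "u v = 0")
      case False
      obtain j where j: "v = B' j" using \<open>v \<in> t - {B' i}\<close> t(2) by blast
      with that False have "j \<in> I" "j \<noteq> i" by (auto simp: I_def)
      moreover from this have "g i \<noteq> g j" using g by (auto simp: bij_def dest: injD)
      ultimately show ?thesis using j off[of "g i" j] i(2) by simp
    qed simp
    then have "(\<Sum>v\<in>t - {B' i}. u v * v (p (g i))) = 0" by (simp add: sum.neutral)
    moreover have "(\<Sum>v\<in>t. u v * v (p (g i))) = 0"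
      using fun_cong[OF t(3), of "p (g i)"] by (simp add: sum_fun_apply)
    ultimately have "u (B' i) * B' i (p (g i)) = 0"
      using i(1) t(1) by (simp add: I_def sum.remove[of t "B' i"])
    then show False using i(1) diag by (simp add: I_def)
  qed
  \<comment> \<open>Solve for the leading term \<open>B j\<close>: the remaining \<open>B k\<close>
    have \<open>k\<close> above \<open>j\<close>, hence strictly fewer indices above them.\<close>
  moreover have "B j \<in> fs.span (range B')" for j
  proof (induction "card {k. R j k}" arbitrary: j rule: less_induct)
    case less
    obtain i where i: "j = g i" using g by (metis bij_pointE)
    have "B k \<in> fs.span (range B')" if "k \<in># M i" for k
    proof (rule less)
      have "R j k" using M[OF that] i by simp
      then have "{l. R k l} \<subset> {l. R j l}"
        using R by (auto dest: transpD asympD)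
      then show "card {l. R k l} < card {l. R j l}" by (rule psubset_card_mono[OF fin])
    qed
    then have "B' i - (\<Sum>k\<in>#M i. B k) \<in> fs.span (range B')"
      by (intro fs.span_diff sum_mset_in_span) (auto intro: fs.span_base)
    then show ?case using B'[of i] i by simp
  qed
  moreover have "B' i \<in> fs.span (range B)" for i
    unfolding B' by (intro fs.span_add sum_mset_in_span) (auto intro: fs.span_base)
  ultimately show ?thesis
    using inj fs.span_eq[of "range B" "range B'"] span by (auto simp: is_basis_def)
qed

section \<open>The graded dual\<close>

text \<open>A letter \<open>a\<close> of a permutation has exactly \<open>a - 1\<close> smaller
  letters and occurs once, so its label is \<open>a\<close>.\<close>

lemma std_permutation:
  assumes "w \<in> permutations_of_set {1..n}"
  shows "std w = w"
proof (rule nth_equalityI)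
  show "length (std w) = length w" by (simp add: std_def)
  fix i assume "i < length (std w)"
  then have i: "i < length w" by (simp add: std_def)
  have w: "set w = {1..n}" "distinct w" using assms by (auto simp: permutations_of_set_def)
  have wi: "w ! i \<in> {1..n}" using i w(1) nth_mem by blast
  let ?J = "{j. j < length w \<and> w ! j < w ! i}"
  have "(!) w ` ?J = {1..<w ! i}"
  proof (intro set_eqI iffI)
    fix x assume "x \<in> (!) w ` ?J"
    then obtain j where "j < length w" "x = w ! j" "w ! j < w ! i" by auto
    moreover from this have "x \<in> {1..n}" using w(1) nth_mem by blast
    ultimately show "x \<in> {1..<w ! i}" by simp
  next
    fix x assume x: "x \<in> {1..<w ! i}"
    then have "x \<in> set w" using wi w(1) by auto
    then show "x \<in> (!) w ` ?J" using x by (auto simp: in_set_conv_nth)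
  qed
  moreover have "inj_on ((!) w) ?J" using w(2) by (auto intro!: inj_onI simp: nth_eq_iff_index_eq)
  ultimately have "card ?J = w ! i - 1" using card_image by fastforce
  moreover have "{j. j \<le> i \<and> w ! j = w ! i} = {i}"
    using i w(2) by (auto simp: nth_eq_iff_index_eq)
  ultimately show "std w ! i = w ! i" using i wi by (simp add: std_def)
qed

text \<open>The only permutation among the words of \<open>F_FQSym \<sigma>\<close> is the inverse
  of \<sigma>, so permutations serve as test words.\<close>

lemma F_FQSym_inv_perm:
  assumes "\<sigma> \<in> permutations_of_set {1..n}" "\<pi> \<in> permutations_of_set {1..m}"
  shows "F_FQSym \<sigma> (inv_perm \<pi>) = (if \<sigma> = \<pi> then 1 else 0)"
proof -
  note \<pi> = inv_perm_permutation[OF assms(2)]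
  have "0 \<notin> set (inv_perm \<pi>)" using permutations_of_setD(1)[OF \<pi>] by simp
  then show ?thesis
    using std_permutation[OF \<pi>] inv_perm_inject[OF assms] by (auto simp: F_FQSym_def)
qed

lemma finite_sylvester_class: "finite (sylvester_class T)"
  by (simp add: sylvester_class_def)

text \<open>The canonical word of \<open>S\<close> lies in the sylvester class of \<open>S\<close>
  and in no other. This supplies the coefficient forms dual to \<open>P_PBT\<close>.\<close>

lemma P_PBT_inv_canonical_word:
  "P_PBT T (inv_perm (canonical_word S)) = (if S = T then 1 else 0)"
proof -
  let ?c = "canonical_word S"
  have "P_PBT T (inv_perm ?c) = (\<Sum>\<sigma>\<in>sylvester_class T. if \<sigma> = ?c then 1 else 0)"
    unfolding P_PBT_def sum_fun_apply
    by (intro sum.cong refl F_FQSym_inv_perm[OF _ canonical_word_permutation])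
      (auto simp: sylvester_class_def)
  also have "\<dots> = (if ?c \<in> sylvester_class T then 1 else 0)"
    using finite_sylvester_class by simp
  also have "?c \<in> sylvester_class T \<longleftrightarrow> S = T"
    using canonical_word_in_class shape_bst_of_canonical_word by (auto simp: sylvester_class_def)
  finally show ?thesis .
qed

lemma P_PBT_support: "P_PBT T w \<noteq> 0 \<Longrightarrow> length w = size T"
proof -
  assume "P_PBT T w \<noteq> 0"
  then obtain \<sigma> where \<sigma>: "\<sigma> \<in> sylvester_class T" "std w = inv_perm \<sigma>"
    by (auto simp: P_PBT_def sum_fun_apply F_FQSym_def elim!: sum.not_neutral_contains_not_neutral
        split: if_splits)
  have "length w = length (std w)" by (simp add: std_def)
  also have "\<dots> = size T"
    using \<sigma> length_permutation[of \<sigma> "size T"] by (simp add: sylvester_class_def)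
  finally show ?thesis .
qed

lemma P_PBT_in_PBT: "P_PBT T \<in> PBT"
  by (simp add: PBT_def fs.span_base)

lemma PBT_dual_eqI:
  assumes \<phi>: "\<phi> \<in> PBT_dual" and \<psi>: "\<psi> \<in> PBT_dual" and eq: "\<And>T. \<phi> (P_PBT T) = \<psi> (P_PBT T)"
  shows "\<phi> = \<psi>"
proof (rule ext)
  fix f
  show "\<phi> f = \<psi> f"
  proof (cases "f \<in> PBT")
    case True
    then have "f \<in> fs.span (range P_PBT)" by (simp add: PBT_def)
    \<comment> \<open>Membership is carried along because the forms are known to be linear only on
      \<open>PBT\<close>.\<close>
    then have "f \<in> PBT \<and> \<phi> f = \<psi> f"
    proof (induction rule: fs.span_induct_alt)
      case base
      have z: "0 \<in> PBT" by (simp add: PBT_def fs.span_zero)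
      \<comment> \<open>Homogeneity with scalar 0 forces both forms to vanish at 0.\<close>
      have "\<phi> (fscale 0 0) = 0 * \<phi> 0" "\<psi> (fscale 0 0) = 0 * \<psi> 0"
        using \<phi> \<psi> z unfolding PBT_dual_def by blast+
      then show ?case using z by (simp del: zero_fun_apply)
    next
      case (step c x y)
      then obtain T where x: "x = P_PBT T" by blast
      have "x \<in> PBT" "fscale c x \<in> PBT" unfolding x PBT_def
        by (auto intro: fs.span_base fs.span_scale)
      moreover from this have "fscale c x + y \<in> PBT"
        using step unfolding PBT_def by (auto intro: fs.span_add)
      ultimately show ?case
        using step \<phi> \<psi> eq[of T] x unfolding PBT_dual_def
        by (simp del: plus_fun_apply fscale_apply)
    qed
    then show ?thesis by simp
  qed (use \<phi> \<psi> in \<open>simp add: PBT_dual_def\<close>)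
qed

lemma subspace_PBT_dual: "fs.subspace PBT_dual"
proof (rule fs.subspaceI)
  show "0 \<in> PBT_dual" by (simp add: PBT_dual_def)
next
  fix \<phi> \<psi> :: "(nat list \<Rightarrow> 'a) \<Rightarrow> 'a"
  assume \<phi>: "\<phi> \<in> PBT_dual" and \<psi>: "\<psi> \<in> PBT_dual"
  let ?N = "\<lambda>\<phi> :: (nat list \<Rightarrow> 'a) \<Rightarrow> 'a. {n. \<exists>f \<in> PBT_homogeneous n. \<phi> f \<noteq> 0}"
  have "?N (\<phi> + \<psi>) \<subseteq> ?N \<phi> \<union> ?N \<psi>" by auto
  moreover have "finite (?N \<phi> \<union> ?N \<psi>)" using \<phi> \<psi> by (simp add: PBT_dual_def)
  ultimately have "finite (?N (\<phi> + \<psi>))" by (rule finite_subset)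
  then show "\<phi> + \<psi> \<in> PBT_dual"
    using \<phi> \<psi> by (simp add: PBT_dual_def algebra_simps)
next
  fix c and \<phi> :: "(nat list \<Rightarrow> 'a) \<Rightarrow> 'a"
  assume \<phi>: "\<phi> \<in> PBT_dual"
  let ?N = "\<lambda>\<phi> :: (nat list \<Rightarrow> 'a) \<Rightarrow> 'a. {n. \<exists>f \<in> PBT_homogeneous n. \<phi> f \<noteq> 0}"
  have "?N (fscale c \<phi>) \<subseteq> ?N \<phi>" by auto
  moreover have "finite (?N \<phi>)" using \<phi> by (simp add: PBT_dual_def)
  ultimately have "finite (?N (fscale c \<phi>))" by (rule finite_subset)
  then show "fscale c \<phi> \<in> PBT_dual"
    using \<phi> by (simp add: PBT_dual_def algebra_simps)
qed

text \<open>A word with nonzero coefficient in \<open>\<^bold>P\<^sub>S\<close> determines \<open>S\<close>, so reading off the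
  coefficient of one such word of \<open>\<^bold>P\<^sub>T\<close> is a dual form; this makes \<open>\<^bold>Q\<^sub>T\<close> explicit.\<close>

lemma Q_PBT_characterization:
  shows Q_PBT_in_dual: "(Q_PBT T :: (nat list \<Rightarrow> 'a::field_char_0) \<Rightarrow> 'a) \<in> PBT_dual"
    and Q_PBT_P_PBT: "Q_PBT T (P_PBT S :: nat list \<Rightarrow> 'a) = (if S = T then 1 else 0)"
proof -
  let ?w = "inv_perm (canonical_word T)"
  define \<phi> :: "(nat list \<Rightarrow> 'a) \<Rightarrow> 'a" where "\<phi> = (\<lambda>f. if f \<in> PBT then f ?w else 0)"
  have "{n. \<exists>f \<in> PBT_homogeneous n. \<phi> f \<noteq> 0} \<subseteq> {length ?w}"
    by (auto simp: PBT_homogeneous_def \<phi>_def)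
  then have fin: "finite {n. \<exists>f \<in> PBT_homogeneous n. \<phi> f \<noteq> 0}"
    by (rule finite_subset) simp
  have "f + g \<in> PBT" "fscale c f \<in> PBT"
    if "f \<in> PBT" "g \<in> PBT" for f g :: "nat list \<Rightarrow> 'a" and c
    using that by (auto simp: PBT_def fs.span_add fs.span_scale)
  with fin have \<phi>: "\<phi> \<in> PBT_dual" by (simp add: PBT_dual_def \<phi>_def)
  have dual: "\<phi> (P_PBT S) = (if S = T then 1 else 0)" for S
    using P_PBT_in_PBT P_PBT_inv_canonical_word[of S T] by (auto simp: \<phi>_def)
  have "Q_PBT T = \<phi>"
    unfolding Q_PBT_def
    by (rule the_equality) (use \<phi> dual in \<open>auto intro!: PBT_dual_eqI\<close>)
  then show "(Q_PBT T :: (nat list \<Rightarrow> 'a) \<Rightarrow> 'a) \<in> PBT_dual"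
    "Q_PBT T (P_PBT S :: nat list \<Rightarrow> 'a) = (if S = T then 1 else 0)"
    using \<phi> dual by simp_all
qed

lemma finite_trees_of_size: "finite {T :: unit tree. size T = n}"
proof (rule finite_imageD)
  have "canonical_word ` {T. size T = n} \<subseteq> permutations_of_set {1..n}"
    using canonical_word_permutation by auto
  then show "finite (canonical_word ` {T. size T = n})" by (rule finite_subset) simp
  show "inj_on canonical_word {T. size T = n}"
    using inj_canonical_word by (rule inj_on_subset) simp
qed

text \<open>A form in the graded dual sees finitely many degrees, \<open>P_PBT T\<close> is
  homogeneous of degree \<open>size T\<close>, and each degree has finitely many trees. So the
  expansion of the form in the \<open>Q_PBT T\<close> is a finite sum.\<close>

lemma span_Q_PBT:
  "fs.span (range Q_PBT) = (PBT_dual :: ((nat list \<Rightarrow> 'k::field_char_0) \<Rightarrow> 'k) set)"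
proof (intro equalityI subsetI)
  fix \<phi> :: "(nat list \<Rightarrow> 'k) \<Rightarrow> 'k"
  assume "\<phi> \<in> fs.span (range Q_PBT)"
  then show "\<phi> \<in> PBT_dual"
    using fs.span_minimal[OF _ subspace_PBT_dual] Q_PBT_in_dual by blast
next
  fix \<phi> :: "(nat list \<Rightarrow> 'k) \<Rightarrow> 'k"
  assume \<phi>: "\<phi> \<in> PBT_dual"
  define X where "X = {T. \<phi> (P_PBT T) \<noteq> 0}"
  let ?N = "{n. \<exists>f \<in> PBT_homogeneous n. \<phi> f \<noteq> 0}"
  have "P_PBT T \<in> PBT_homogeneous (size T)" for T
    using P_PBT_in_PBT P_PBT_support by (auto simp: PBT_homogeneous_def)
  then have "X \<subseteq> (\<Union>n \<in> ?N. {T. size T = n})" by (auto simp: X_def)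
  moreover have "finite (\<Union>n \<in> ?N. {T :: unit tree. size T = n})"
    using \<phi> finite_trees_of_size by (simp add: PBT_dual_def)
  ultimately have X: "finite X" by (rule finite_subset)
  let ?\<psi> = "\<Sum>T\<in>X. fscale (\<phi> (P_PBT T)) (Q_PBT T)"
  have "\<phi> = ?\<psi>"
  proof (rule PBT_dual_eqI[OF \<phi>])
    show "?\<psi> \<in> PBT_dual"
      by (intro fs.subspace_sum fs.subspace_scale subspace_PBT_dual Q_PBT_in_dual)
    show "\<phi> (P_PBT S) = ?\<psi> (P_PBT S)" for S
      using X by (simp add: sum_fun_apply Q_PBT_P_PBT X_def if_distrib cong: if_cong)
  qed
  also have "?\<psi> \<in> fs.span (range Q_PBT)"
    by (intro fs.span_sum fs.span_scale fs.span_base) auto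
  finally show "\<phi> \<in> fs.span (range Q_PBT)" .
qed

section \<open>The transition matrix\<close>

definition inverse_tree :: "unit tree \<Rightarrow> unit tree" where
  "inverse_tree T = shape (bst_of (inv_perm (canonical_word T)))"

text \<open>This is the equality case of \<open>inverse_class_comparison\<close>; it shows that the
  inverse of a canonical word is canonical.\<close>

lemma canonical_word_inverse_tree: "canonical_word (inverse_tree T) = inv_perm (canonical_word T)"
  using inverse_class_comparison[OF canonical_word_in_class] by (simp add: inverse_tree_def)

lemma size_shape_bst_of_inv_perm:
  "\<sigma> \<in> sylvester_class T \<Longrightarrow> size (shape (bst_of (inv_perm \<sigma>))) = size T"
  using length_permutation[of \<sigma> "size T"] by (simp add: sylvester_class_def)

lemma size_inverse_tree: "size (inverse_tree T) = size T"
  unfolding inverse_tree_def by (rule size_shape_bst_of_inv_perm[OF canonical_word_in_class])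

text \<open>Injectivity comes from inversion and canonical words being injective; surjectivity
  follows because size is preserved and each size has finitely many trees.\<close>

lemma bij_inverse_tree: "bij inverse_tree"
proof (rule bijI)
  show inj: "inj inverse_tree"
  proof (rule injI)
    fix S T assume "inverse_tree S = inverse_tree T"
    then have "inv_perm (canonical_word S) = inv_perm (canonical_word T)"
      by (metis canonical_word_inverse_tree)
    then have "canonical_word S = canonical_word T"
      by (rule inv_perm_inject[OF canonical_word_permutation canonical_word_permutation])
    then show "S = T" using inj_canonical_word by (auto dest: injD)
  qed
  show "surj inverse_tree"
  proof
    show "UNIV \<subseteq> range inverse_tree"
    proof
      fix T :: "unit tree"
      let ?X = "{S :: unit tree. size S = size T}"
      have "inverse_tree ` ?X = ?X"
        using inj by (intro endo_inj_surj finite_trees_of_size)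
          (auto simp: size_inverse_tree intro: inj_on_subset)
      then show "T \<in> range inverse_tree" by blast
    qed
  qed simp
qed

text \<open>A multiset, since different words of the class may yield the same tree.\<close>

definition upper_terms :: "unit tree \<Rightarrow> unit tree multiset" where
  "upper_terms T = image_mset (\<lambda>\<sigma>. shape (bst_of (inv_perm \<sigma>)))
     (mset_set (sylvester_class T - {canonical_word T}))"

lemma Q'_PBT_expansion:
  "Q'_PBT T = Q_PBT (inverse_tree T) + (\<Sum>S\<in>#upper_terms T. Q_PBT S)"
  unfolding Q'_PBT_def sum.remove[OF finite_sylvester_class canonical_word_in_class]
  by (simp add: upper_terms_def inverse_tree_def sum_unfold_sum_mset image_mset.compositionality
      comp_def)

lemma upper_terms_greater:
  assumes "S \<in># upper_terms T"
  shows "size S = size T" "(canonical_word (inverse_tree T), canonical_word S) \<in> lexord less_than"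
proof -
  obtain \<sigma> where \<sigma>: "\<sigma> \<in> sylvester_class T" "\<sigma> \<noteq> canonical_word T"
    and S: "S = shape (bst_of (inv_perm \<sigma>))"
    using assms finite_sylvester_class by (auto simp: upper_terms_def)
  show "size S = size T" unfolding S by (rule size_shape_bst_of_inv_perm[OF \<sigma>(1)])
  show "(canonical_word (inverse_tree T), canonical_word S) \<in> lexord less_than"
    using inverse_class_comparison[OF \<sigma>(1)] \<sigma>(2) by (simp add: S canonical_word_inverse_tree)
qed

lemma is_basis_Q'_PBT:
  "is_basis (Q'_PBT :: unit tree \<Rightarrow> (nat list \<Rightarrow> 'k::field_char_0) \<Rightarrow> 'k) PBT_dual"
proof (rule unitriangular_is_basis[OF _ span_Q_PBT bij_inverse_tree Q'_PBT_expansion])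
  \<comment> \<open>Requiring equal sizes keeps the set of trees above a given one finite, as the
    spanning induction demands.\<close>
  let ?R = "\<lambda>S T. size S = size T \<and> (canonical_word S, canonical_word T) \<in> lexord less_than"
  show "Q_PBT S (P_PBT T :: nat list \<Rightarrow> 'k) = (if S = T then 1 else 0)" for S T
    by (auto simp: Q_PBT_P_PBT)
  show "?R (inverse_tree T) S" if "S \<in># upper_terms T" for S T
    using upper_terms_greater[OF that] by (simp add: size_inverse_tree)
  have trans: "trans (lexord less_than)" by (simp add: lexord_transI)
  then show "transp ?R" by (auto intro!: transpI elim: transE)
  have "(w, w) \<notin> lexord less_than" for w by (rule lexord_irreflexive) simp
  then show "asymp ?R" using trans by (blast intro: asympI elim: transE)
  show "finite {T. ?R S T}" for S
    by (rule finite_subset[OF _ finite_trees_of_size[of "size S"]]) auto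
qed

theorem mainTheorem14:
  shows "is_basis (Q'_PBT :: unit tree \<Rightarrow> (nat list \<Rightarrow> 'k::field_char_0) \<Rightarrow> 'k) PBT_dual
    \<and> (\<forall>T. \<exists>T' M.
          canonical_word T' = inv_perm (canonical_word T)
        \<and> (\<forall>S \<in># M. (canonical_word T', canonical_word S) \<in> lexord less_than)
        \<and> (Q'_PBT T :: (nat list \<Rightarrow> 'k) \<Rightarrow> 'k) = Q_PBT T' + (\<Sum>S\<in>#M. Q_PBT S))"
  using is_basis_Q'_PBT canonical_word_inverse_tree upper_terms_greater(2) Q'_PBT_expansion
  by blast

end
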